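(* Let $H$ be a Hilbert space and let $T$ be a regular (bounded linear) operator defined on $H$. Then the following statements are equivalent: (i) $T$ is a Moore-Penrose hermitian operator; (ii) there exist two orthogonal Hilbert subspaces $H_1$ and $H_2$ of $H$ such that $H=H_1\oplus H_2$, $T|_{H_1}=0$, $T(H_2)\subseteq H_2$, and, if $T_2$ denotes the restriction of $T$ to $H_2$, then $T_2^2=I_2$, where $I_2$ denotes the identity map of $H_2$.
   Context: A bounded linear operator $T\colon H\to H$ is called regular if it has a generalized inverse, i.e. there is a bounded linear operator $T'$ on $H$ with $T=TT'T$. A regular operator $T$ has a unique Moore-Penrose inverse $T^{\dagger}$, namely the unique bounded linear operator on $H$ satisfying $T=TT^{\dagger}T$, $T^{\dagger}=T^{\dagger}TT^{\dagger}$, $(TT^{\dagger})^*=TT^{\dagger}$, $(T^{\dagger}T)^*=T^{\dagger}T$. The operator $T$ is called Moore-Penrose hermitian if it has a Moore-Penrose inverse and $T^{\dagger}=T$. Hilbert subspaces are closed linear subspaces. *)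

theory Defs
  imports "HOL-Analysis.Analysis"
begin

text \<open>
  The scalar field of a Hilbert space is \<^typ>\<open>real\<close> or \<^typ>\<open>complex\<close>.  By the theorem of
  Gelfand and Mazur (in the form: a commutative field over the reals with a multiplicative norm
  is isometrically isomorphic to one of these two), every \<^class>\<open>real_normed_field\<close> is a copy of
  one of them, and the axioms below force \<open>sconj\<close> to be the identity or the complex
  conjugation, respectively.
\<close>

class real_or_complex = real_normed_field +
  fixes sconj :: "'a \<Rightarrow> 'a"
  assumes sconj_add: "sconj (x + y) = sconj x + sconj y"
    and mult_sconj: "x * sconj x = (norm x)\<^sup>2 *\<^sub>R 1"

instantiation real :: real_or_complex
begin
definition sconj_real :: "real \<Rightarrow> real" where "sconj_real x = x"
instance by standard (simp_all add: sconj_real_def power2_eq_square)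
end

instantiation complex :: real_or_complex
begin
definition sconj_complex :: "complex \<Rightarrow> complex" where "sconj_complex = cnj"
instance by standard (simp_all add: sconj_complex_def scaleR_conv_of_real flip: complex_norm_square)
end

text \<open>
  The whole type \<open>'a\<close> is the Hilbert space; its norm and completeness come from \<^class>\<open>banach\<close>.
  The inner product is linear in its first argument.
\<close>

locale hilbert_space = vector_space scl
  for scl :: "'k::real_or_complex \<Rightarrow> 'a::banach \<Rightarrow> 'a" +
  fixes ip :: "'a \<Rightarrow> 'a \<Rightarrow> 'k"
  assumes scale_of_real: "scl (of_real r) x = r *\<^sub>R x"
    and ip_add_left: "ip (x + y) z = ip x z + ip y z"
    and ip_scale_left: "ip (scl c x) y = c * ip x y"
    and ip_sconj: "ip y x = sconj (ip x y)"
    and ip_norm: "ip x x = of_real ((norm x)\<^sup>2)"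

lemma hilbert_space_real:
  "hilbert_space ((*\<^sub>R) :: real \<Rightarrow> 'a::{real_inner,banach} \<Rightarrow> 'a) inner"
  by unfold_locales
    (simp_all add: sconj_real_def inner_add_left power2_norm_eq_inner scaleR_add_right
      scaleR_add_left, rule inner_commute)

lemma hilbert_space_complex:
  "hilbert_space ((*) :: complex \<Rightarrow> complex \<Rightarrow> complex) (\<lambda>x y. x * cnj y)"
  by unfold_locales
    (simp_all add: sconj_complex_def algebra_simps scaleR_conv_of_real flip: complex_norm_square)

definition bounded_operator :: "('k::real_or_complex \<Rightarrow> 'a::banach \<Rightarrow> 'a) \<Rightarrow> ('a \<Rightarrow> 'a) \<Rightarrow> bool"
  where "bounded_operator scl T \<longleftrightarrow>
    Vector_Spaces.linear scl scl T \<and> (\<exists>B. \<forall>x. norm (T x) \<le> B * norm x)"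

definition regular_operator :: "('k::real_or_complex \<Rightarrow> 'a::banach \<Rightarrow> 'a) \<Rightarrow> ('a \<Rightarrow> 'a) \<Rightarrow> bool"
  where "regular_operator scl T \<longleftrightarrow>
    bounded_operator scl T \<and> (\<exists>T'. bounded_operator scl T' \<and> T = T \<circ> T' \<circ> T)"

text \<open>On a Hilbert space every bounded operator has exactly one adjoint, by the Riesz
  representation theorem.\<close>

definition adj ::
  "('k::real_or_complex \<Rightarrow> 'a::banach \<Rightarrow> 'a) \<Rightarrow> ('a \<Rightarrow> 'a \<Rightarrow> 'k) \<Rightarrow> ('a \<Rightarrow> 'a) \<Rightarrow> 'a \<Rightarrow> 'a"
  where "adj scl ip T =
    (THE S. bounded_operator scl S \<and> (\<forall>x y. ip (T x) y = ip x (S y)))"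

definition is_moore_penrose_inverse ::
  "('k::real_or_complex \<Rightarrow> 'a::banach \<Rightarrow> 'a) \<Rightarrow> ('a \<Rightarrow> 'a \<Rightarrow> 'k) \<Rightarrow> ('a \<Rightarrow> 'a) \<Rightarrow> ('a \<Rightarrow> 'a) \<Rightarrow> bool"
  where "is_moore_penrose_inverse scl ip T S \<longleftrightarrow>
    bounded_operator scl S \<and>
    T = T \<circ> S \<circ> T \<and> S = S \<circ> T \<circ> S \<and>
    adj scl ip (T \<circ> S) = T \<circ> S \<and> adj scl ip (S \<circ> T) = S \<circ> T"

definition moore_penrose_inverse ::
  "('k::real_or_complex \<Rightarrow> 'a::banach \<Rightarrow> 'a) \<Rightarrow> ('a \<Rightarrow> 'a \<Rightarrow> 'k) \<Rightarrow> ('a \<Rightarrow> 'a) \<Rightarrow> 'a \<Rightarrow> 'a"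
  where "moore_penrose_inverse scl ip T = (THE S. is_moore_penrose_inverse scl ip T S)"

definition moore_penrose_hermitian ::
  "('k::real_or_complex \<Rightarrow> 'a::banach \<Rightarrow> 'a) \<Rightarrow> ('a \<Rightarrow> 'a \<Rightarrow> 'k) \<Rightarrow> ('a \<Rightarrow> 'a) \<Rightarrow> bool"
  where "moore_penrose_hermitian scl ip T \<longleftrightarrow>
    (\<exists>S. is_moore_penrose_inverse scl ip T S) \<and> moore_penrose_inverse scl ip T = T"

definition hilbert_subspace :: "('k::real_or_complex \<Rightarrow> 'a::banach \<Rightarrow> 'a) \<Rightarrow> 'a set \<Rightarrow> bool"
  where "hilbert_subspace scl S \<longleftrightarrow> module.subspace scl S \<and> closed S"

definition orthogonal_subspaces :: "('a \<Rightarrow> 'a \<Rightarrow> 'k::zero) \<Rightarrow> 'a set \<Rightarrow> 'a set \<Rightarrow> bool"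
  where "orthogonal_subspaces ip S1 S2 \<longleftrightarrow> (\<forall>x\<in>S1. \<forall>y\<in>S2. ip x y = 0)"

definition is_direct_sum :: "'a::ab_group_add set \<Rightarrow> 'a set \<Rightarrow> bool"
  where "is_direct_sum S1 S2 \<longleftrightarrow> {x + y | x y. x \<in> S1 \<and> y \<in> S2} = UNIV \<and> S1 \<inter> S2 = {0}"

end

theory Submission
  imports Defs
begin

text \<open>
  Every bounded operator is adjointable, by the Riesz representation theorem
  (\<open>riesz_representation\<close>, \<open>adjoint_exists\<close>).  Hence the condition \<open>adj scl ip P = P\<close> in the
  definition of the Moore-Penrose inverse does say that \<open>P\<close> is symmetric for the inner product
  (\<open>adj_eq_self_iff\<close>), and Moore-Penrose inverses are unique (\<open>moore_penrose_inverse_unique\<close>).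
  Consequently a bounded \<open>T\<close> is Moore-Penrose hermitian exactly when it is a Moore-Penrose
  inverse of itself, that is, when \<open>T\<^sup>3 = T\<close> and \<open>T\<^sup>2\<close> is symmetric
  (\<open>moore_penrose_hermitian_iff\<close>).

  In that case \<open>P = T\<^sup>2\<close> is an idempotent symmetric operator, that is, an orthogonal projection.
  Its range \<open>{x. T (T x) = x}\<close> is mapped to itself by \<open>T\<close>, which acts there as an involution; its
  kernel is the kernel of \<open>T\<close>, because \<open>T = T P\<close>.  These are the two subspaces.  Conversely, if
  \<open>T\<close> vanishes on \<open>H\<^sub>1\<close> and is an involution of \<open>H\<^sub>2\<close>, then \<open>T\<^sup>2\<close> is the projection onto \<open>H\<^sub>2\<close>
  along \<open>H\<^sub>1\<close>; it is symmetric because the summands are orthogonal, and \<open>T\<^sup>3 = T\<close> can be read off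
  on each summand.
\<close>

section \<open>Conjugation of scalars\<close>

lemma sconj_0 [simp]: "sconj (0::'k::real_or_complex) = 0"
  using sconj_add[of "0::'k" 0] by simp

text \<open>
  The norm axiom can be solved for \<open>sconj x\<close> if \<open>x \<noteq> 0\<close>.  Multiplicativity, the fixed real
  scalars and the isometry of \<open>sconj\<close> are read off from this formula.
\<close>

lemma sconj_eq:
  fixes x :: "'k::real_or_complex"
  assumes "x \<noteq> 0"
  shows "sconj x = of_real ((norm x)\<^sup>2) / x"
  using mult_sconj[of x] assms by (simp add: field_simps of_real_def)

lemma sconj_minus: "sconj (- x) = - sconj (x::'k::real_or_complex)"
  using sconj_add[of x "- x"] by (simp add: eq_neg_iff_add_eq_0 add.commute)

lemma sconj_mult: "sconj (x * y) = sconj x * sconj (y::'k::real_or_complex)"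
  by (cases "x = 0 \<or> y = 0") (auto simp: sconj_eq norm_mult power_mult_distrib)

lemma sconj_of_real [simp]: "sconj (of_real r :: 'k::real_or_complex) = of_real r"
  by (cases "r = 0") (auto simp: sconj_eq power2_eq_square)

lemma norm_sconj [simp]: "norm (sconj (x::'k::real_or_complex)) = norm x"
  by (cases "x = 0") (auto simp: sconj_eq norm_divide power2_eq_square simp del: of_real_mult)

section \<open>Inner products\<close>

context hilbert_space
begin

lemma ip_add_right: "ip x (y + z) = ip x y + ip x z"
  by (metis ip_sconj ip_add_left sconj_add)

lemma ip_scale_right: "ip x (scl c y) = sconj c * ip x y"
  by (metis ip_sconj ip_scale_left sconj_mult)

lemma ip_minus_left: "ip (- x) y = - ip x y"
  by (metis ip_add_left add.right_neutral add_cancel_left_right eq_neg_iff_add_eq_0 neg_eq_iff_add_eq_0)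

lemma ip_minus_right: "ip x (- y) = - ip x y"
  by (metis ip_sconj ip_minus_left sconj_minus)

lemma ip_diff_left: "ip (x - y) z = ip x z - ip y z"
  using ip_add_left[of x "- y" z] by (simp add: ip_minus_left)

lemma ip_diff_right: "ip x (y - z) = ip x y - ip x z"
  using ip_add_right[of x y "- z"] by (simp add: ip_minus_right)

lemma ip_zero_left [simp]: "ip 0 y = 0"
  using ip_diff_left[of 0 0 y] by simp

lemma ip_eq_zeroI: "ip x x = 0 \<Longrightarrow> x = 0"
  by (simp add: ip_norm)

lemma eq_if_ip_right_eq:
  assumes "\<And>z. ip z x = ip z y"
  shows "x = y"
proof -
  have "ip (x - y) (x - y) = 0"
    by (simp add: assms ip_diff_right)
  then show ?thesis
    using ip_eq_zeroI by force
qed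

lemma eq_if_ip_left_eq:
  assumes "\<And>z. ip x z = ip y z"
  shows "x = y"
  by (rule eq_if_ip_right_eq) (metis assms ip_sconj)

lemma parallelogram:
  fixes x y :: 'a
  shows "(norm (x + y))\<^sup>2 + (norm (x - y))\<^sup>2 = 2 * (norm x)\<^sup>2 + 2 * (norm y)\<^sup>2"
proof -
  have "of_real ((norm (x + y))\<^sup>2 + (norm (x - y))\<^sup>2)
      = ip (x + y) (x + y) + ip (x - y) (x - y)"
    by (simp only: ip_norm of_real_add)
  also have "\<dots> = 2 * ip x x + 2 * ip y y"
    by (simp add: ip_add_left ip_add_right ip_diff_left ip_diff_right)
  also have "\<dots> = of_real (2 * (norm x)\<^sup>2 + 2 * (norm y)\<^sup>2)"
    by (simp only: ip_norm of_real_add of_real_mult of_real_numeral)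
  finally show ?thesis
    by (simp only: of_real_eq_iff)
qed

text \<open>
  The Pythagorean identity for subtracting from \<open>x\<close> its component along \<open>y\<close>.  It yields the
  Cauchy-Schwarz inequality, and it shows that a vector whose norm does not decrease when
  multiples of \<open>y\<close> are subtracted is orthogonal to \<open>y\<close>.
\<close>

lemma norm_diff_component:
  assumes "y \<noteq> 0"
  shows "(norm (x - scl (ip x y / of_real ((norm y)\<^sup>2)) y))\<^sup>2
    = (norm x)\<^sup>2 - (norm (ip x y))\<^sup>2 / (norm y)\<^sup>2"
proof -
  define N where "N = (norm y)\<^sup>2"
  define c where "c = ip x y / of_real N"
  have N: "N \<noteq> 0"
    using assms by (simp add: N_def)
  have "sconj c * of_real N = sconj (c * of_real N)"
    by (simp add: sconj_mult)
  then have c: "c * of_real N = ip x y" "sconj c * of_real N = ip y x"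
    using N by (simp_all add: c_def ip_sconj[of y x])
  have a: "ip x y * ip y x = of_real ((norm (ip x y))\<^sup>2)"
    using mult_sconj[of "ip x y"] by (simp add: of_real_def flip: ip_sconj)
  have "of_real ((norm (x - scl c y))\<^sup>2) = ip (x - scl c y) (x - scl c y)"
    by (simp only: ip_norm)
  also have "\<dots> = ip x x - sconj c * ip x y - c * ip y x + c * (sconj c * ip y y)"
    by (simp add: ip_diff_left ip_diff_right ip_scale_left ip_scale_right algebra_simps)
  also have "\<dots> = ip x x - sconj c * ip x y"
    using c(2) by (simp only: ip_norm N_def) simp
  also have "sconj c * ip x y = ip x y * ip y x / of_real N"
    using N c by (simp add: field_simps)
  also have "ip x x - \<dots> = of_real ((norm x)\<^sup>2 - (norm (ip x y))\<^sup>2 / N)"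
    by (simp add: a ip_norm)
  finally show ?thesis
    unfolding of_real_eq_iff c_def N_def .
qed

lemma cauchy_schwarz: "norm (ip x y) \<le> norm x * norm y"
proof (cases "y = 0")
  case True
  then show ?thesis
    using ip_diff_right[of x 0 0] by simp
next
  case False
  have "0 \<le> (norm x)\<^sup>2 - (norm (ip x y))\<^sup>2 / (norm y)\<^sup>2"
    unfolding norm_diff_component[OF False, symmetric] by simp
  then have "(norm (ip x y))\<^sup>2 \<le> (norm x * norm y)\<^sup>2"
    using False by (simp add: field_simps)
  then show ?thesis
    by (rule power2_le_imp_le) simp
qed

section \<open>Riesz representation\<close>

text \<open>
  A minimizing sequence in the affine hyperplane \<open>f = 1\<close> is a Cauchy sequence: midpoints stay in
  the hyperplane, so the parallelogram identity bounds the distances by the defects from the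
  infimum.  The vector that represents \<open>f\<close> will be a multiple of the minimizer.
\<close>

lemma minimal_norm_on_hyperplane:
  fixes f :: "'a \<Rightarrow> 'k"
  assumes add: "\<And>x y. f (x + y) = f x + f y"
    and scale: "\<And>c x. f (scl c x) = c * f x"
    and bound: "\<And>x. norm (f x) \<le> B * norm x"
    and nz: "f z \<noteq> 0"
  obtains u where "f u = 1" "\<And>x. f x = 1 \<Longrightarrow> norm u \<le> norm x"
proof -
  define F where "F = {x. f x = 1}"
  define D where "D = Inf ((\<lambda>x. (norm x)\<^sup>2) ` F)"
  have "scl (inverse (f z)) z \<in> F"
    using nz by (simp add: F_def scale)
  then have ne: "(\<lambda>x. (norm x)\<^sup>2) ` F \<noteq> {}"
    by blast
  have bdd: "bdd_below ((\<lambda>x. (norm x)\<^sup>2) ` F)"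
    by (rule bdd_belowI[of _ 0]) auto
  have D_le: "D \<le> (norm x)\<^sup>2" if "x \<in> F" for x
    unfolding D_def using bdd that by (intro cInf_lower) auto
  have "\<exists>x\<in>F. (norm x)\<^sup>2 < D + 1 / real (Suc n)" for n
    using cInf_lessD[OF ne, of "D + 1 / real (Suc n)"] by (auto simp: D_def[symmetric])
  then obtain X where XF: "\<And>n. X n \<in> F" and X: "\<And>n. (norm (X n))\<^sup>2 < D + 1 / real (Suc n)"
    by metis
  have scaleR: "f (r *\<^sub>R x) = of_real r * f x" for r x
    by (metis scale scale_of_real)
  have dist_X: "(norm (X m - X n))\<^sup>2 < 2 * (1 / real (Suc m)) + 2 * (1 / real (Suc n))" for m n
  proof -
    have "(1/2) *\<^sub>R (X m + X n) \<in> F"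
      using XF[of m] XF[of n] by (simp add: F_def scaleR add)
    from D_le[OF this] have "4 * D \<le> (norm (X m + X n))\<^sup>2"
      by (simp add: power_divide)
    then show ?thesis
      using parallelogram[of "X m" "X n"] X[of m] X[of n] by linarith
  qed
  have "Cauchy X"
  proof (rule metric_CauchyI)
    fix e :: real
    assume "e > 0"
    then obtain M where M: "inverse (real (Suc M)) < e\<^sup>2 / 4"
      using reals_Archimedean[of "e\<^sup>2 / 4"] by auto
    have "dist (X m) (X n) < e" if "m \<ge> M" "n \<ge> M" for m n
    proof -
      have "1 / real (Suc k) \<le> inverse (real (Suc M))" if "k \<ge> M" for k
        using that by (simp add: field_simps)
      from this[OF \<open>m \<ge> M\<close>] this[OF \<open>n \<ge> M\<close>] have "(norm (X m - X n))\<^sup>2 < e\<^sup>2"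
        using dist_X[of m n] M by linarith
      then show ?thesis
        using \<open>e > 0\<close> by (simp add: dist_norm power2_less_imp_less)
    qed
    then show "\<exists>M. \<forall>m\<ge>M. \<forall>n\<ge>M. dist (X m) (X n) < e"
      by blast
  qed
  then obtain u where u: "X \<longlonglongrightarrow> u"
    by (auto simp: Cauchy_convergent_iff convergent_def)
  have "bounded_linear f"
    by (rule bounded_linear_intro[of f B]) (simp_all add: add scaleR bound mult.commute scaleR_conv_of_real)
  from bounded_linear.tendsto[OF this u] have "f u = 1"
    using XF by (simp add: F_def LIMSEQ_const_iff)
  moreover have "norm u \<le> norm x" if "f x = 1" for x
  proof -
    have "(\<lambda>n. D + 1 / real (Suc n)) \<longlonglongrightarrow> D + 0"
      by (intro tendsto_intros LIMSEQ_Suc lim_1_over_n)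
    moreover have "(\<lambda>n. (norm (X n))\<^sup>2) \<longlonglongrightarrow> (norm u)\<^sup>2"
      by (intro tendsto_intros u)
    ultimately have "(norm u)\<^sup>2 \<le> D"
      using X by (intro LIMSEQ_le[of _ "(norm u)\<^sup>2" _ D]) (auto intro: less_imp_le)
    also have "D \<le> (norm x)\<^sup>2"
      using that by (simp add: D_le F_def)
    finally show ?thesis
      by (rule power2_le_imp_le) simp
  qed
  ultimately show ?thesis
    by (rule that)
qed

text \<open>
  The minimizer \<open>u\<close> is orthogonal to the kernel of \<open>f\<close>, since moving along the kernel stays in the
  hyperplane.  As \<open>x - f x u\<close> lies in the kernel, \<open>\<langle>x, u\<rangle> = f x \<parallel>u\<parallel>\<^sup>2\<close>.
\<close>

theorem riesz_representation:
  fixes f :: "'a \<Rightarrow> 'k"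
  assumes add: "\<And>x y. f (x + y) = f x + f y"
    and scale: "\<And>c x. f (scl c x) = c * f x"
    and bound: "\<And>x. norm (f x) \<le> B * norm x"
  shows "\<exists>w. \<forall>x. f x = ip x w"
proof (cases "\<forall>z. f z = 0")
  case True
  then show ?thesis
    using ip_diff_right[of _ 0 0] by (intro exI[of _ 0]) simp
next
  case False
  then obtain u where u: "f u = 1" and min: "\<And>x. f x = 1 \<Longrightarrow> norm u \<le> norm x"
    using minimal_norm_on_hyperplane[of f B] assms by metis
  have diff: "f (x - y) = f x - f y" for x y
    using add[of "x - y" y] by simp
  have orth: "ip v u = 0" if v: "f v = 0" for v
  proof (cases "v = 0")
    case v0: False
    have "norm u \<le> norm (u - scl (ip u v / of_real ((norm v)\<^sup>2)) v)"
      by (rule min) (simp add: diff scale u v)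
    then have "(norm u)\<^sup>2 \<le> (norm u)\<^sup>2 - (norm (ip u v))\<^sup>2 / (norm v)\<^sup>2"
      unfolding norm_diff_component[OF v0, symmetric] by (rule power_mono) simp
    moreover have "(norm v)\<^sup>2 > 0"
      using v0 by simp
    ultimately have "(norm (ip u v))\<^sup>2 \<le> 0"
      by (simp add: field_simps)
    then show ?thesis
      by (simp add: ip_sconj[of v u])
  qed simp
  define N where "N = (norm u)\<^sup>2"
  have "u \<noteq> 0"
    using u diff[of 0 0] by auto
  then have N: "N \<noteq> 0"
    by (simp add: N_def)
  have "f x = ip x (scl (of_real (inverse N)) u)" for x
  proof -
    have "ip (x - scl (f x) u) u = 0"
      by (rule orth) (simp add: diff scale u)
    then have "ip x u = f x * of_real N"
      by (simp add: ip_diff_left ip_scale_left ip_norm N_def)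
    then show ?thesis
      using N by (simp add: ip_scale_right del: of_real_inverse) (simp add: field_simps)
  qed
  then show ?thesis
    by blast
qed

section \<open>Adjoints\<close>

lemma bounded_operator_iff:
  "bounded_operator scl T \<longleftrightarrow>
    (\<forall>x y. T (x + y) = T x + T y) \<and> (\<forall>c x. T (scl c x) = scl c (T x)) \<and>
    (\<exists>B. \<forall>x. norm (T x) \<le> B * norm x)"
  unfolding bounded_operator_def Vector_Spaces.linear_iff using vector_space_axioms by blast

lemma bounded_operator_bound:
  assumes "bounded_operator scl T"
  obtains B where "B \<ge> 0" "\<And>x. norm (T x) \<le> B * norm x"
proof -
  from assms obtain B where B: "\<And>x. norm (T x) \<le> B * norm x"
    by (auto simp: bounded_operator_def)
  have "norm (T x) \<le> \<bar>B\<bar> * norm x" for x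
    by (rule order_trans[OF B mult_right_mono]) simp_all
  then show ?thesis
    using that[of "\<bar>B\<bar>"] by simp
qed

lemma bounded_operator_compose:
  assumes "bounded_operator scl S" "bounded_operator scl T"
  shows "bounded_operator scl (S \<circ> T)"
proof -
  obtain A where A: "A \<ge> 0" "\<And>x. norm (S x) \<le> A * norm x"
    using bounded_operator_bound[OF assms(1)] by blast
  obtain B where B: "B \<ge> 0" "\<And>x. norm (T x) \<le> B * norm x"
    using bounded_operator_bound[OF assms(2)] by blast
  have "norm (S (T x)) \<le> (A * B) * norm x" for x
    using order_trans[OF A(2) mult_left_mono[OF B(2) A(1)]] by (simp add: mult.assoc)
  then show ?thesis
    using assms by (auto simp: bounded_operator_iff)
qed

lemma bounded_operator_bounded_linear:
  assumes "bounded_operator scl T"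
  shows "bounded_linear T"
proof -
  obtain B where "\<And>x. norm (T x) \<le> B * norm x"
    using bounded_operator_bound[OF assms] by blast
  moreover have "T (r *\<^sub>R x) = r *\<^sub>R T x" for r x
    using assms by (metis bounded_operator_iff scale_of_real)
  ultimately show ?thesis
    using assms by (intro bounded_linear_intro[of T B]) (simp_all add: bounded_operator_iff mult.commute)
qed

text \<open>
  Riesz representation of \<open>x \<mapsto> \<langle>T x, y\<rangle>\<close> gives \<open>S y\<close>.  Testing against \<open>x = S y\<close> bounds \<open>S\<close> by the
  norm of \<open>T\<close>.
\<close>

lemma adjoint_exists:
  assumes "bounded_operator scl T"
  shows "\<exists>S. bounded_operator scl S \<and> (\<forall>x y. ip (T x) y = ip x (S y))"
proof -
  obtain B where B: "B \<ge> 0" "\<And>x. norm (T x) \<le> B * norm x"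
    using bounded_operator_bound[OF assms] by blast
  have "\<exists>w. \<forall>x. ip (T x) y = ip x w" for y
  proof (rule riesz_representation)
    show "norm (ip (T x) y) \<le> (B * norm y) * norm x" for x
      using order_trans[OF cauchy_schwarz mult_right_mono[OF B(2) norm_ge_zero], of x y]
      by (simp add: ac_simps)
  qed (use assms in \<open>auto simp: bounded_operator_iff ip_add_left ip_scale_left\<close>)
  then obtain S where S: "\<And>x y. ip (T x) y = ip x (S y)"
    by metis
  have "norm (S y) \<le> B * norm y" for y
  proof (cases "S y = 0")
    case False
    have "(norm (S y))\<^sup>2 = norm (ip (T (S y)) y)"
      by (simp add: S ip_norm norm_power)
    also have "\<dots> \<le> B * norm (S y) * norm y"
      by (rule order_trans[OF cauchy_schwarz mult_right_mono[OF B(2)]]) simp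
    finally show ?thesis
      using False by (simp add: power2_eq_square)
  qed (use B in simp)
  moreover have "S (x + y) = S x + S y" for x y
    by (rule eq_if_ip_right_eq) (simp add: ip_add_right flip: S)
  moreover have "S (scl c y) = scl c (S y)" for c y
    by (rule eq_if_ip_right_eq) (simp add: ip_scale_right flip: S)
  ultimately show ?thesis
    using S by (auto simp: bounded_operator_iff)
qed

text \<open>
  The definite description in \<open>adj\<close> denotes a genuine adjoint only because an adjoint exists
  (Riesz) and is unique (the inner product is definite).
\<close>

lemma adj_eq_self_iff:
  assumes "bounded_operator scl T"
  shows "adj scl ip T = T \<longleftrightarrow> (\<forall>x y. ip (T x) y = ip x (T y))"
proof -
  obtain S where S: "bounded_operator scl S" "\<And>x y. ip (T x) y = ip x (S y)"
    using adjoint_exists[OF assms] by blast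
  have unique: "R = S" if "\<And>x y. ip (T x) y = ip x (R y)" for R
    by (rule ext, rule eq_if_ip_right_eq) (metis that S(2))
  have "adj scl ip T = S"
    unfolding adj_def by (rule the_equality) (use S unique in blast)+
  then show ?thesis
    using S(2) unique[of T] by metis
qed

section \<open>Moore-Penrose inverses\<close>

lemma is_moore_penrose_inverse_iff:
  assumes "bounded_operator scl T"
  shows "is_moore_penrose_inverse scl ip T S \<longleftrightarrow>
    bounded_operator scl S \<and>
    (\<forall>x. T (S (T x)) = T x) \<and> (\<forall>x. S (T (S x)) = S x) \<and>
    (\<forall>x y. ip (T (S x)) y = ip x (T (S y))) \<and> (\<forall>x y. ip (S (T x)) y = ip x (S (T y)))"
proof (cases "bounded_operator scl S")
  case True
  have generalized_inverse_iff: "f = f \<circ> g \<circ> f \<longleftrightarrow> (\<forall>x. f (g (f x)) = f x)"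
    for f g :: "'a \<Rightarrow> 'a"
    unfolding fun_eq_iff comp_apply by (intro iff_allI eq_commute)
  show ?thesis
    unfolding is_moore_penrose_inverse_def generalized_inverse_iff
      adj_eq_self_iff[OF bounded_operator_compose[OF assms True]]
      adj_eq_self_iff[OF bounded_operator_compose[OF True assms]] comp_apply ..
qed (simp add: is_moore_penrose_inverse_def)

text \<open>
  If \<open>S\<close> and \<open>S'\<close> are Moore-Penrose inverses of \<open>T\<close>, then \<open>T S\<close> and \<open>T S'\<close> are symmetric
  projections onto the range of \<open>T\<close>, hence equal; and \<open>S T\<close> and \<open>S' T\<close> are symmetric projections
  along the kernel of \<open>T\<close>, hence equal.  So \<open>S = S T S = S T S' = S' T S' = S'\<close>.
\<close>

lemma moore_penrose_inverse_unique:
  assumes T: "bounded_operator scl T"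
    and "is_moore_penrose_inverse scl ip T S" "is_moore_penrose_inverse scl ip T S'"
  shows "S = S'"
proof
  fix x
  have S: "\<And>x. T (S (T x)) = T x" "\<And>x. S (T (S x)) = S x"
      "\<And>x y. ip (T (S x)) y = ip x (T (S y))" "\<And>x y. ip (S (T x)) y = ip x (S (T y))"
    and S': "\<And>x. T (S' (T x)) = T x" "\<And>x. S' (T (S' x)) = S' x"
      "\<And>x y. ip (T (S' x)) y = ip x (T (S' y))" "\<And>x y. ip (S' (T x)) y = ip x (S' (T y))"
    using assms(2,3) unfolding is_moore_penrose_inverse_iff[OF T] by iprover+
  have range_proj: "T (S x) = T (S' x)" for x
  proof (rule eq_if_ip_left_eq)
    fix y
    have "ip (T (S x)) y = ip (T (S' (T (S x)))) y"
      by (simp add: S')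
    also have "\<dots> = ip x (T (S (T (S' y))))"
      by (simp only: S'(3) S(3))
    also have "\<dots> = ip (T (S' x)) y"
      by (simp only: S(1) S'(3))
    finally show "ip (T (S x)) y = ip (T (S' x)) y" .
  qed
  have kernel_proj: "S (T x) = S' (T x)" for x
  proof (rule eq_if_ip_left_eq)
    fix y
    have "ip (S (T x)) y = ip (S (T (S' (T x)))) y"
      by (simp add: S')
    also have "\<dots> = ip x (S' (T (S (T y))))"
      by (simp only: S'(4) S(4))
    also have "\<dots> = ip (S' (T x)) y"
      by (simp only: S(1) S'(4))
    finally show "ip (S (T x)) y = ip (S' (T x)) y" .
  qed
  have "S x = S (T (S' x))"
    by (simp add: S flip: range_proj)
  also have "\<dots> = S' x"
    by (simp add: kernel_proj S')
  finally show "S x = S' x" .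
qed

lemma moore_penrose_hermitian_iff:
  assumes T: "bounded_operator scl T"
  shows "moore_penrose_hermitian scl ip T \<longleftrightarrow>
    (\<forall>x. T (T (T x)) = T x) \<and> (\<forall>x y. ip (T (T x)) y = ip x (T (T y)))"
proof -
  have "moore_penrose_inverse scl ip T = S" if "is_moore_penrose_inverse scl ip T S" for S
    unfolding moore_penrose_inverse_def
    by (rule the_equality, rule that, rule moore_penrose_inverse_unique[OF T _ that])
  then have "moore_penrose_hermitian scl ip T \<longleftrightarrow> is_moore_penrose_inverse scl ip T T"
    unfolding moore_penrose_hermitian_def by metis
  then show ?thesis
    unfolding is_moore_penrose_inverse_iff[OF T] using T by iprover
qed

section \<open>The orthogonal decomposition\<close>

text \<open>
  \<open>x = (x - T\<^sup>2 x) + T\<^sup>2 x\<close> splits \<open>x\<close>, and \<open>\<langle>x, y\<rangle> = \<langle>x, T\<^sup>2 y\<rangle> = \<langle>T\<^sup>2 x, y\<rangle> = 0\<close> for \<open>x\<close> in the kernel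
  and \<open>y\<close> fixed by \<open>T\<^sup>2\<close>.
\<close>

lemma decomposition_if_symmetric_square:
  assumes T: "bounded_operator scl T"
    and cube: "\<And>x. T (T (T x)) = T x"
    and sym: "\<And>x y. ip (T (T x)) y = ip x (T (T y))"
  defines "H1 \<equiv> {x. T x = 0}" and "H2 \<equiv> {x. T (T x) = x}"
  shows "hilbert_subspace scl H1" "hilbert_subspace scl H2"
    and "orthogonal_subspaces ip H1 H2" "is_direct_sum H1 H2"
proof -
  have blin: "bounded_linear T"
    using T by (rule bounded_operator_bounded_linear)
  then have zero: "T 0 = 0" and diff: "\<And>x y. T (x - y) = T x - T y"
    by (simp_all add: linear_simps)
  have add: "\<And>x y. T (x + y) = T x + T y" and scale: "\<And>c x. T (scl c x) = scl c (T x)"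
    using T by (auto simp: bounded_operator_iff)
  have cont: "continuous_on UNIV T"
    using blin by (rule linear_continuous_on)
  then have cont2: "continuous_on UNIV (\<lambda>x. T (T x))"
    by (rule continuous_on_compose2) (use cont in auto)
  have "closed H1" "closed H2"
    unfolding H1_def H2_def by (intro closed_Collect_eq cont cont2 continuous_intros)+
  then show "hilbert_subspace scl H1" "hilbert_subspace scl H2"
    by (auto simp: hilbert_subspace_def subspace_def H1_def H2_def zero add scale)
  show "orthogonal_subspaces ip H1 H2"
    unfolding orthogonal_subspaces_def
  proof (intro ballI)
    fix x y
    assume "x \<in> H1" "y \<in> H2"
    then have "ip x y = ip (T (T x)) y"
      by (simp add: sym H2_def)
    also have "\<dots> = 0"
      using \<open>x \<in> H1\<close> by (simp add: H1_def zero)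
    finally show "ip x y = 0" .
  qed
  have "\<exists>y z. x = y + z \<and> y \<in> H1 \<and> z \<in> H2" for x
    by (intro exI[of _ "x - T (T x)"] exI[of _ "T (T x)"])
      (simp add: H1_def H2_def diff cube)
  moreover have "H1 \<inter> H2 = {0}"
    by (auto simp: H1_def H2_def zero)
  ultimately show "is_direct_sum H1 H2"
    by (auto simp: is_direct_sum_def)
qed

text \<open>
  \<open>T\<^sup>2\<close> maps \<open>u + v\<close> to \<open>v\<close>, for \<open>u \<in> H1\<close> and \<open>v \<in> H2\<close>.  By orthogonality both sides of the symmetry
  identity reduce to the inner product of the components in \<open>H2\<close>.
\<close>

lemma symmetric_square_if_decomposition:
  assumes T: "bounded_operator scl T"
    and orth: "orthogonal_subspaces ip H1 H2"
    and dsum: "is_direct_sum H1 H2"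
    and null: "\<And>x. x \<in> H1 \<Longrightarrow> T x = 0"
    and invol: "\<And>x. x \<in> H2 \<Longrightarrow> T (T x) = x"
  shows "T (T (T x)) = T x" "ip (T (T x)) y = ip x (T (T y))"
proof -
  have add: "\<And>x y. T (x + y) = T x + T y"
    using T by (simp add: bounded_operator_iff)
  have decomp: "\<exists>u v. u \<in> H1 \<and> v \<in> H2 \<and> x = u + v" for x
    using dsum unfolding is_direct_sum_def by blast
  have zero: "T 0 = 0"
    using add[of 0 0] by simp
  obtain u v where uv: "u \<in> H1" "v \<in> H2" "x = u + v"
    using decomp by blast
  obtain u' v' where uv': "u' \<in> H1" "v' \<in> H2" "y = u' + v'"
    using decomp by blast
  show "T (T (T x)) = T x"
    using uv by (simp add: add null invol zero)
  have "ip u v' = 0" "ip v u' = 0"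
    using orth uv uv' ip_sconj[of v u'] by (auto simp: orthogonal_subspaces_def)
  then show "ip (T (T x)) y = ip x (T (T y))"
    using uv uv' by (simp add: add null invol zero ip_add_left ip_add_right)
qed

end

theorem theorem5p2:
  fixes scl :: "'k::real_or_complex \<Rightarrow> 'a::banach \<Rightarrow> 'a"
    and ip :: "'a \<Rightarrow> 'a \<Rightarrow> 'k"
    and T :: "'a \<Rightarrow> 'a"
  assumes "hilbert_space scl ip"
    and "regular_operator scl T"
  shows "moore_penrose_hermitian scl ip T \<longleftrightarrow>
    (\<exists>H1 H2. hilbert_subspace scl H1 \<and> hilbert_subspace scl H2 \<and>
       orthogonal_subspaces ip H1 H2 \<and> is_direct_sum H1 H2 \<and>
       (\<forall>x\<in>H1. T x = 0) \<and> T ` H2 \<subseteq> H2 \<and> (\<forall>x\<in>H2. T (T x) = x))"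
    (is "_ \<longleftrightarrow> ?decomposition")
proof -
  interpret hilbert_space scl ip by fact
  have T: "bounded_operator scl T"
    using assms(2) by (simp add: regular_operator_def)
  show ?thesis
    unfolding moore_penrose_hermitian_iff[OF T]
  proof (intro iffI)
    assume "(\<forall>x. T (T (T x)) = T x) \<and> (\<forall>x y. ip (T (T x)) y = ip x (T (T y)))"
    then show ?decomposition
      using decomposition_if_symmetric_square[OF T]
      by (intro exI[of _ "{x. T x = 0}"] exI[of _ "{x. T (T x) = x}"]) auto
  next
    assume ?decomposition
    then obtain H1 H2 where H: "orthogonal_subspaces ip H1 H2" "is_direct_sum H1 H2"
      "\<forall>x\<in>H1. T x = 0" "\<forall>x\<in>H2. T (T x) = x"
      by iprover
    show "(\<forall>x. T (T (T x)) = T x) \<and> (\<forall>x y. ip (T (T x)) y = ip x (T (T y)))"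
      by (intro conjI allI symmetric_square_if_decomposition[OF T H(1,2)]) (use H(3,4) in simp_all)
  qed
qed

end
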